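(* Let $R=\mathbb{K}[x_1,\ldots,x_n]$ be a polynomial ring over a field $\mathbb{K}$ of prime characteristic $p>0$, with fraction field $K$ and $\mathfrak{m}=(x_1,\ldots,x_n)$. Let $\mathfrak{a}_\bullet$ be a filtration of monomial ideals in $R$ and let $v$ be a valuation of $K$ supported on $R$. If $\widehat{v}(\mathfrak{a}_\bullet)>0$, then $$\mathcal{C}^{\mathfrak{m}}(\mathfrak{a}_\bullet)\le\frac{v(x_1\cdots x_n)}{\widehat{v}(\mathfrak{a}_\bullet)}.$$ Moreover, if $v(\mathfrak{m})>0$ and $\mathcal{C}^{\mathfrak{m}}(\mathfrak{a}_\bullet)$ exists, then $\widehat{v}(\mathfrak{a}_\bullet)>0$.
   Context: A filtration of ideals in $R$ is a sequence $\mathfrak{a}_\bullet=\{\mathfrak{a}_i\}_{i\ge 0}$ of ideals with $\mathfrak{a}_0=R$, $\mathfrak{a}_{i+1}\subseteq\mathfrak{a}_i$, and $\mathfrak{a}_i\mathfrak{a}_j\subseteq \mathfrak{a}_{i+j}$ for all $i,j\ge 0$. Valuations are real-valued (with $v(0)=\infty$); $v$ is supported on $R$ if $v(f)\ge 0$ for all $f\in R\setminus\{0\}$. For an ideal $J$, $v(J)=\min\{v(f):f\in J\setminus\{0\}\}$ (with $v((0))=\infty$), and the skew Waldschmidt constant is $\widehat{v}(\mathfrak{a}_\bullet)=\lim_{r\to\infty}v(\mathfrak{a}_r)/r=\inf_{r\ge 1}v(\mathfrak{a}_r)/r$. $\mathfrak{m}^{[p^e]}=(x_1^{p^e},\ldots,x_n^{p^e})$,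 $\nu_{\mathfrak{a}_\bullet}^{\mathfrak{m}}(p^e)=\sup\{r\in\mathbb{Z}_{\ge 0}:\mathfrak{a}_r\not\subseteq\mathfrak{m}^{[p^e]}\}$, and $\mathcal{C}^{\mathfrak{m}}(\mathfrak{a}_\bullet)=\lim_{e\to\infty}\nu_{\mathfrak{a}_\bullet}^{\mathfrak{m}}(p^e)/p^e$, said to exist when the limit exists and is a finite real number. *)

theory Defs
  imports
    "HOL-Library.Poly_Mapping"
    "HOL-Library.Extended_Real"
    "HOL-Computational_Algebra.Fraction_Field"
    "HOL-Computational_Algebra.Primes"
begin

section \<open>Ideals\<close>

text \<open>
  An ideal of a commutative ring is a submodule of the ring regarded as a module over itself.
\<close>

global_interpretation ideal: module "(*) :: 'a::comm_ring_1 \<Rightarrow> 'a \<Rightarrow> 'a"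
  by standard (simp_all add: algebra_simps)

abbreviation is_ideal :: "'a::comm_ring_1 set \<Rightarrow> bool"
  where "is_ideal \<equiv> module.subspace (*)"

abbreviation ideal_gen :: "'a::comm_ring_1 set \<Rightarrow> 'a set"
  where "ideal_gen \<equiv> module.span (*)"

definition ideal_prod :: "'a::comm_ring_1 set \<Rightarrow> 'a set \<Rightarrow> 'a set"
  where "ideal_prod I J = ideal_gen {f * g |f g. f \<in> I \<and> g \<in> J}"

definition ideal_filtration :: "(nat \<Rightarrow> 'a::comm_ring_1 set) \<Rightarrow> bool"
  where "ideal_filtration \<aa> \<longleftrightarrow>
    (\<forall>i. is_ideal (\<aa> i)) \<and>
    \<aa> 0 = UNIV \<and>
    (\<forall>i. \<aa> (Suc i) \<subseteq> \<aa> i) \<and>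
    (\<forall>i j. ideal_prod (\<aa> i) (\<aa> j) \<subseteq> \<aa> (i + j))"


section \<open>Valuations\<close>

text \<open>
  Real-valued valuations of a field; the values lie in \<^typ>\<open>ereal\<close> to accommodate \<open>v 0 = \<infinity>\<close>.
\<close>

definition valuation :: "('f::field \<Rightarrow> ereal) \<Rightarrow> bool"
  where "valuation v \<longleftrightarrow>
    v 0 = \<infinity> \<and>
    (\<forall>f. f \<noteq> 0 \<longrightarrow> \<bar>v f\<bar> \<noteq> \<infinity>) \<and>
    (\<forall>f g. v (f * g) = v f + v g) \<and>
    (\<forall>f g. v (f + g) \<ge> min (v f) (v g))"

definition fract_of :: "'a::idom \<Rightarrow> 'a fract"
  where "fract_of f = Fraction_Field.Fract f 1"

definition supported_on_ring :: "('a::idom fract \<Rightarrow> ereal) \<Rightarrow> bool"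
  where "supported_on_ring v \<longleftrightarrow> (\<forall>f. f \<noteq> 0 \<longrightarrow> v (fract_of f) \<ge> 0)"

text \<open>
  The infimum below is a minimum whenever \<open>J\<close> is a nonzero finitely generated ideal and \<open>v\<close> is
  supported on the ring (it is attained at a generator), in particular for every nonzero
  ideal of a polynomial ring in finitely many variables over a field. The infimum over the
  empty set is \<open>\<infinity>\<close>, which is the convention for \<open>J = {0}\<close>.
\<close>

definition val_ideal :: "('a::idom fract \<Rightarrow> ereal) \<Rightarrow> 'a set \<Rightarrow> ereal"
  where "val_ideal v J = (INF f \<in> J - {0}. v (fract_of f))"

text \<open>
  The limit is taken in the extended reals: it is \<open>\<infinity>\<close> if the ideals of the filtration eventually
  vanish. Its existence, and its equality with the infimum, is \<open>skew_waldschmidt_limit\<close> below.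
\<close>

definition skew_waldschmidt ::
    "('a::idom fract \<Rightarrow> ereal) \<Rightarrow> (nat \<Rightarrow> 'a set) \<Rightarrow> ereal"
  where "skew_waldschmidt v \<aa> = lim (\<lambda>r. val_ideal v (\<aa> r) / ereal (real r))"

lemma val_ideal_antimono: "I \<subseteq> J \<Longrightarrow> val_ideal v J \<le> val_ideal v I"
  unfolding val_ideal_def by (rule INF_superset_mono) auto

lemma val_ideal_nonneg: "supported_on_ring v \<Longrightarrow> 0 \<le> val_ideal v J"
  unfolding val_ideal_def supported_on_ring_def by (auto intro!: INF_greatest)

lemma filtrationD:
  assumes "ideal_filtration \<aa>"
  shows "\<aa> 0 = UNIV" and "\<aa> (Suc i) \<subseteq> \<aa> i" and "ideal_prod (\<aa> i) (\<aa> j) \<subseteq> \<aa> (i + j)"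
  using assms by (simp_all add: ideal_filtration_def)

lemma valuationD:
  assumes "valuation v"
  shows "x \<noteq> 0 \<Longrightarrow> \<bar>v x\<bar> \<noteq> \<infinity>" and "v (x * y) = v x + v y"
  using assms by (simp_all add: valuation_def)

lemma filtration_antimono:
  assumes "ideal_filtration \<aa>" and "i \<le> j"
  shows "\<aa> j \<subseteq> \<aa> i"
  using assms(2)
proof (induction rule: dec_induct)
  case base
  then show ?case by simp
next
  case (step k)
  then show ?case using filtrationD(2)[OF assms(1), of k] by (meson order_trans)
qed

lemma filtration_power:
  assumes F: "ideal_filtration \<aa>" and f: "f \<in> \<aa> k"
  shows "f ^ q \<in> \<aa> (q * k)"
proof (induction q)
  case 0
  then show ?case using filtrationD(1)[OF F] by simp
next
  case (Suc q)
  have "f * f ^ q \<in> ideal_prod (\<aa> k) (\<aa> (q * k))"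
    unfolding ideal_prod_def using f Suc by (intro ideal.span_base) blast
  then have "f * f ^ q \<in> \<aa> (k + q * k)"
    using filtrationD(3)[OF F] by (rule subsetD[rotated])
  then show ?case by simp
qed

lemma fract_of_mult: "fract_of (f * g) = fract_of f * fract_of g"
  by (simp add: fract_of_def)

lemma fract_of_eq_0_iff: "fract_of f = 0 \<longleftrightarrow> f = 0"
  by (simp add: fract_of_def Zero_fract_def eq_fract)

lemma valuation_power:
  assumes "valuation v" and "f \<noteq> 0" and "v (fract_of f) = ereal x"
  shows "v (fract_of (f ^ Suc q)) = ereal (real (Suc q) * x)"
proof (induction q)
  case 0
  then show ?case using assms(3) by simp
next
  case (Suc q)
  have "v (fract_of (f ^ Suc (Suc q))) = v (fract_of f) + v (fract_of (f ^ Suc q))"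
    by (simp only: power_Suc[of f "Suc q"] fract_of_mult valuationD(2)[OF assms(1)])
  also have "\<dots> = ereal (x + real (Suc q) * x)"
    by (simp only: Suc assms(3) plus_ereal.simps(1))
  also have "x + real (Suc q) * x = real (Suc (Suc q)) * x"
    by (simp add: algebra_simps)
  finally show ?case .
qed

lemma skew_waldschmidt_limit:
  assumes F: "ideal_filtration \<aa>" and V: "valuation v" and S: "supported_on_ring v"
  shows "(\<lambda>r. val_ideal v (\<aa> r) / ereal (real r))
           \<longlonglongrightarrow> (INF r\<in>{1..}. val_ideal v (\<aa> r) / ereal (real r))"
    (is "?s \<longlonglongrightarrow> ?L")
proof (rule order_tendstoI)
  fix x assume x: "x < ?L"
  have "x < ?s r" if "r \<ge> 1" for r
    using that by (intro less_le_trans[OF x] INF_lower) simp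
  then show "eventually (\<lambda>r. x < ?s r) sequentially"
    by (rule eventually_sequentiallyI)
next
  fix x assume "?L < x"
  then obtain k where k: "k \<ge> 1" "?s k < x"
    unfolding INF_less_iff by auto
  have "val_ideal v (\<aa> k) < x * ereal (real k)"
    using k by (simp add: ereal_divide_less_iff mult.commute)
  then obtain f where f: "f \<in> \<aa> k" "f \<noteq> 0" "v (fract_of f) < x * ereal (real k)"
    unfolding val_ideal_def INF_less_iff by blast
  obtain y where y: "v (fract_of f) = ereal y"
  proof -
    have "\<bar>v (fract_of f)\<bar> \<noteq> \<infinity>"
      by (rule valuationD(1)[OF V]) (simp add: fract_of_eq_0_iff f(2))
    then show ?thesis using that by (cases "v (fract_of f)") auto
  qed
  have "ereal (y / real k) < x"
  proof (cases x)
    case (real z)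
    then have "y < z * real k" using f(3) y by simp
    then show ?thesis using k(1) real by (simp add: pos_divide_less_eq)
  next
    case PInf
    then show ?thesis by simp
  next
    case MInf
    then show ?thesis using f(3) k(1) y by simp
  qed
  have "0 \<le> v (fract_of f)" using S f(2) unfolding supported_on_ring_def by blast
  then have y0: "y \<ge> 0" using y by simp
  have bound: "?s r \<le> ereal (y / real k + y / real r)" if r: "r \<ge> 1" for r
  proof -
    define q where "q = r div k"
    have rq: "r \<le> Suc q * k"
      using k(1) dividend_less_div_times[of k r] unfolding q_def by simp
    have "f ^ Suc q \<in> \<aa> r"
      using filtration_power[OF F f(1), of "Suc q"] filtration_antimono[OF F rq] by blast
    then have "val_ideal v (\<aa> r) \<le> v (fract_of (f ^ Suc q))"
      unfolding val_ideal_def using f(2) by (intro INF_lower) simp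
    also have "\<dots> = ereal (real (Suc q) * y)"
      by (rule valuation_power[OF V f(2) y])
    finally have "?s r \<le> ereal (real (Suc q) * y) / ereal (real r)"
      using r by (intro ereal_divide_right_mono) auto
    also have "\<dots> = ereal (real (Suc q) * y / real r)"
      using r by simp
    also have "\<dots> \<le> ereal (y / real k + y / real r)"
    proof -
      have "real q \<le> real r / real k" unfolding q_def by (rule of_nat_div_le_of_nat)
      then have "real (Suc q) * y \<le> (real r / real k + 1) * y"
        using y0 by (intro mult_right_mono) auto
      then have "real (Suc q) * y / real r \<le> (real r / real k + 1) * y / real r"
        by (intro divide_right_mono) auto
      also have "\<dots> = y / real k + y / real r"
        using r by (simp add: field_simps)
      finally show ?thesis by simp
    qed
    finally show ?thesis .
  qed
  have "(\<lambda>r. y / real k + y / real r) \<longlonglongrightarrow> y / real k + 0"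
    by (intro tendsto_add tendsto_const lim_const_over_n)
  then have "(\<lambda>r. ereal (y / real k + y / real r)) \<longlonglongrightarrow> ereal (y / real k)"
    by simp
  then have "eventually (\<lambda>r. ereal (y / real k + y / real r) < x) sequentially"
    using \<open>ereal (y / real k) < x\<close> by (rule order_tendstoD(2))
  then show "eventually (\<lambda>r. ?s r < x) sequentially"
    using eventually_ge_at_top[of 1]
  proof eventually_elim
    case (elim r)
    then show ?case using le_less_trans[OF bound[of r]] by simp
  qed
qed

lemma skew_waldschmidt_eq_INF:
  assumes "ideal_filtration \<aa>" and "valuation v" and "supported_on_ring v"
  shows "skew_waldschmidt v \<aa> = (INF r\<in>{1..}. val_ideal v (\<aa> r) / ereal (real r))"
  unfolding skew_waldschmidt_def by (rule limI[OF skew_waldschmidt_limit[OF assms]])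


section \<open>Polynomials and monomial ideals\<close>

text \<open>
  The polynomial ring \<open>K[x\<^sub>1, \<dots>, x\<^sub>n]\<close>: the variables are indexed by a finite type \<^typ>\<open>'n\<close> with
  \<open>n = CARD('n)\<close> elements, and a polynomial maps exponent vectors to coefficients.
  The library's integral domain instance, which the fraction field requires, asks for a linear
  order on the index type; it plays no other role, and the numeral types give every \<open>n \<ge> 1\<close>.
\<close>

type_synonym ('n, 'k) mpoly = "('n \<Rightarrow>\<^sub>0 nat) \<Rightarrow>\<^sub>0 'k"

definition var :: "'n \<Rightarrow> ('n, 'k::comm_ring_1) mpoly"
  where "var i = Poly_Mapping.single (Poly_Mapping.single i 1) 1"

definition monomial_ideal :: "('n, 'k::comm_ring_1) mpoly set \<Rightarrow> bool"
  where "monomial_ideal I \<longleftrightarrow>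
    (\<exists>A. I = ideal_gen ((\<lambda>\<alpha>. Poly_Mapping.single \<alpha> 1) ` A))"

text \<open>
  \<open>max_ideal_frob q\<close> is the Frobenius power \<open>\<mm>\<close> to the \<open>[q]\<close>, not the ordinary power of the ideal.
\<close>

definition max_ideal_frob :: "nat \<Rightarrow> ('n, 'k::comm_ring_1) mpoly set"
  where "max_ideal_frob q = ideal_gen (range (\<lambda>i. var i ^ q))"

definition max_ideal :: "('n, 'k::comm_ring_1) mpoly set"
  where "max_ideal = ideal_gen (range var)"


section \<open>The F-threshold with respect to the maximal ideal\<close>

text \<open>
  The supremum is taken in the extended reals, since the set of indices may be unbounded. For
  \<open>q \<ge> 1\<close> the set contains \<open>0\<close>, as \<open>\<aa> 0\<close> is the whole ring.
\<close>

definition nu :: "(nat \<Rightarrow> ('n, 'k::comm_ring_1) mpoly set) \<Rightarrow> nat \<Rightarrow> ereal"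
  where "nu \<aa> q = (SUP r \<in> {r. \<not> \<aa> r \<subseteq> max_ideal_frob q}. ereal (real r))"

definition F_threshold :: "nat \<Rightarrow> (nat \<Rightarrow> ('n, 'k::comm_ring_1) mpoly set) \<Rightarrow> ereal"
  where "F_threshold p \<aa> = lim (\<lambda>e. nu \<aa> (p ^ e) / ereal (real (p ^ e)))"

definition F_threshold_exists :: "nat \<Rightarrow> (nat \<Rightarrow> ('n, 'k::comm_ring_1) mpoly set) \<Rightarrow> bool"
  where "F_threshold_exists p \<aa> \<longleftrightarrow>
    (\<exists>c::real. (\<lambda>e. nu \<aa> (p ^ e) / ereal (real (p ^ e))) \<longlonglongrightarrow> ereal c)"

end

theory Submission
  imports Defs
begin

text \<open>
  A monomial ideal is not contained in \<open>\<mm>\<close> to the \<open>[q]\<close> iff it contains a monomial \<open>x\<close> to the \<open>\<alpha>\<close> with all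
  \<open>\<alpha> i < q\<close>. Passing to \<open>m\<close>-th powers of such monomials shows that \<open>\<nu>(p^e) / p^e\<close> is
  nondecreasing in \<open>e\<close>, so only boundedness is at stake. Such a monomial in \<open>\<aa> r\<close> divides
  \<open>(x\<^sub>1 \<cdots> x\<^sub>n)^q\<close>, so that \<open>r\<close> times the skew Waldschmidt constant is at most
  \<open>q v(x\<^sub>1 \<cdots> x\<^sub>n)\<close>. Conversely, if \<open>N\<close> exceeds the F-threshold, then \<open>\<aa> (N p^e)\<close> lies in the
  Frobenius power for \<open>q = p^e\<close>, whose value is at least \<open>p^e v(\<mm>)\<close>; hence the skew Waldschmidt
  constant is at least \<open>v(\<mm>) / N\<close>.
\<close>

section \<open>Monomials and membership in Frobenius powers\<close>

lemma prod_single_one: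
  "(\<Prod>i\<in>A. Poly_Mapping.single (f i) (1::'k::comm_ring_1)) = Poly_Mapping.single (\<Sum>i\<in>A. f i) 1"
  by (induction A rule: infinite_finite_induct) (simp_all add: mult_single)

lemma var_power:
  "(var i :: ('n, 'k::comm_ring_1) mpoly) ^ q = Poly_Mapping.single (Poly_Mapping.single i q) 1"
  by (induction q) (simp_all add: var_def mult_single single_add[symmetric])

text \<open>Lets divisibility between monomials be proved by comparing exponents one variable at a
  time.\<close>

lemma monomial_eq_prod_var:
  fixes \<alpha> :: "'n::finite \<Rightarrow>\<^sub>0 nat"
  shows "Poly_Mapping.single \<alpha> (1::'k::comm_ring_1) = (\<Prod>i\<in>UNIV. var i ^ Poly_Mapping.lookup \<alpha> i)"
proof -
  have "\<alpha> = (\<Sum>i\<in>UNIV. Poly_Mapping.single i (Poly_Mapping.lookup \<alpha> i))"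
    by (rule poly_mapping_eqI) (simp add: lookup_sum lookup_single when_def)
  then show ?thesis
    by (simp add: var_power prod_single_one)
qed

lemma ideal_mem_dvd:
  assumes "is_ideal I" and "f \<in> I" and "f dvd g"
  shows "g \<in> I"
  using assms ideal.subspace_scale[OF assms(1,2)] by (auto simp: dvd_def mult.commute)

text \<open>The polynomials whose every monomial has some exponent at least \<open>q\<close> form an
  ideal, since exponents only grow under multiplication. It contains each generator
  \<open>var i ^ q\<close>, hence the whole span.\<close>

lemma max_ideal_frob_keys:
  fixes f :: "('n, 'k::comm_ring_1) mpoly"
  assumes "f \<in> max_ideal_frob q" and "\<alpha> \<in> Poly_Mapping.keys f"
  shows "\<exists>i. q \<le> Poly_Mapping.lookup \<alpha> i"
proof -
  define P where
    "P = {f :: ('n, 'k) mpoly. \<forall>\<alpha>\<in>Poly_Mapping.keys f. \<exists>i. q \<le> Poly_Mapping.lookup \<alpha> i}"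
  have "is_ideal P"
  proof (rule ideal.subspaceI)
    show "0 \<in> P" by (simp add: P_def)
    show "f + g \<in> P" if "f \<in> P" "g \<in> P" for f g
      using that keys_add[of f g] unfolding P_def by blast
    show "h * f \<in> P" if "f \<in> P" for h f
    proof -
      have "\<exists>i. q \<le> Poly_Mapping.lookup \<gamma> i" if "\<gamma> \<in> Poly_Mapping.keys (h * f)" for \<gamma>
      proof -
        obtain \<alpha> \<beta> where "\<gamma> = \<alpha> + \<beta>" "\<beta> \<in> Poly_Mapping.keys f"
          using \<open>\<gamma> \<in> _\<close> keys_mult[of h f] by blast
        moreover obtain i where "q \<le> Poly_Mapping.lookup \<beta> i"
          using \<open>f \<in> P\<close> calculation(2) unfolding P_def by blast
        ultimately show ?thesis by (auto simp: lookup_add intro!: exI[of _ i])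
      qed
      then show ?thesis by (simp add: P_def)
    qed
  qed
  moreover have "range (\<lambda>i. var i ^ q) \<subseteq> P"
  proof -
    have "\<exists>j. q \<le> Poly_Mapping.lookup (Poly_Mapping.single i q) j" for i :: 'n
      by (rule exI[of _ i]) simp
    then show ?thesis by (auto simp: P_def var_power)
  qed
  ultimately have "max_ideal_frob q \<subseteq> P"
    unfolding max_ideal_frob_def by (rule ideal.span_minimal[rotated])
  then show ?thesis using assms by (auto simp: P_def)
qed

lemma monomial_mem_max_ideal_frob_iff:
  fixes \<alpha> :: "'n::finite \<Rightarrow>\<^sub>0 nat"
  shows "Poly_Mapping.single \<alpha> (1::'k::comm_ring_1) \<in> max_ideal_frob q
    \<longleftrightarrow> (\<exists>i. q \<le> Poly_Mapping.lookup \<alpha> i)"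
proof
  assume "Poly_Mapping.single \<alpha> (1::'k) \<in> max_ideal_frob q"
  then show "\<exists>i. q \<le> Poly_Mapping.lookup \<alpha> i"
    by (rule max_ideal_frob_keys) simp
next
  assume "\<exists>i. q \<le> Poly_Mapping.lookup \<alpha> i"
  then obtain i where "q \<le> Poly_Mapping.lookup \<alpha> i" ..
  then have "var i ^ q dvd (var i ^ Poly_Mapping.lookup \<alpha> i :: ('n, 'k) mpoly)"
    by (rule le_imp_power_dvd)
  also have "\<dots> dvd Poly_Mapping.single \<alpha> 1"
    unfolding monomial_eq_prod_var by (rule dvd_prodI) auto
  finally have "(var i ^ q :: ('n, 'k) mpoly) dvd Poly_Mapping.single \<alpha> 1" .
  then show "Poly_Mapping.single \<alpha> (1::'k) \<in> max_ideal_frob q"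
    unfolding max_ideal_frob_def
    by (rule ideal_mem_dvd[OF ideal.subspace_span ideal.span_base, rotated]) auto
qed

text \<open>If all generating monomials lay in the Frobenius power, which is an ideal, so would
  \<open>I\<close>; hence one of the generators is the required monomial.\<close>

lemma monomial_ideal_not_subset_max_ideal_frob_iff:
  fixes I :: "('n::finite, 'k::comm_ring_1) mpoly set"
  assumes "monomial_ideal I"
  shows "\<not> I \<subseteq> max_ideal_frob q \<longleftrightarrow>
    (\<exists>\<alpha>. Poly_Mapping.single \<alpha> 1 \<in> I \<and> (\<forall>i. Poly_Mapping.lookup \<alpha> i < q))"
proof
  assume not: "\<not> I \<subseteq> max_ideal_frob q"
  obtain A where A: "I = ideal_gen ((\<lambda>\<alpha>. Poly_Mapping.single \<alpha> 1) ` A)"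
    using assms unfolding monomial_ideal_def by blast
  have "\<not> (\<lambda>\<alpha>. Poly_Mapping.single \<alpha> 1) ` A \<subseteq> (max_ideal_frob q :: ('n, 'k) mpoly set)"
    using not ideal.span_minimal[OF _ ideal.subspace_span]
    unfolding A max_ideal_frob_def by blast
  then obtain \<alpha> where "\<alpha> \<in> A" "Poly_Mapping.single \<alpha> (1::'k) \<notin> max_ideal_frob q"
    by blast
  moreover from this have "Poly_Mapping.single \<alpha> (1::'k) \<in> I"
    unfolding A by (intro ideal.span_base) blast
  ultimately show "\<exists>\<alpha>. Poly_Mapping.single \<alpha> 1 \<in> I \<and> (\<forall>i. Poly_Mapping.lookup \<alpha> i < q)"
    by (auto simp: monomial_mem_max_ideal_frob_iff not_le)
next
  assume "\<exists>\<alpha>. Poly_Mapping.single \<alpha> 1 \<in> I \<and> (\<forall>i. Poly_Mapping.lookup \<alpha> i < q)"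
  then show "\<not> I \<subseteq> max_ideal_frob q"
    by (metis monomial_mem_max_ideal_frob_iff not_le subsetD)
qed

text \<open>The \<open>m\<close>-th power of an escaping monomial escapes again: its exponents are
  \<open>m\<close> times the old ones, and \<open>m > 0\<close> keeps the inequality with
  \<open>m * q\<close> strict.\<close>

lemma not_subset_max_ideal_frob_mult:
  fixes \<aa> :: "nat \<Rightarrow> ('n::finite, 'k::comm_ring_1) mpoly set"
  assumes F: "ideal_filtration \<aa>" and M: "\<And>i. monomial_ideal (\<aa> i)"
    and "m > 0" and "\<not> \<aa> r \<subseteq> max_ideal_frob q"
  shows "\<not> \<aa> (m * r) \<subseteq> max_ideal_frob (m * q)"
proof -
  obtain \<alpha> where \<alpha>: "Poly_Mapping.single \<alpha> 1 \<in> \<aa> r" "\<And>i. Poly_Mapping.lookup \<alpha> i < q"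
    using assms(4) unfolding monomial_ideal_not_subset_max_ideal_frob_iff[OF M] by blast
  \<comment> \<open>The power is seen as a product of \<open>m\<close> equal factors so that
    \<open>prod_single_one\<close> adds up the exponents.\<close>
  have "Poly_Mapping.single \<alpha> (1::'k) ^ m = (\<Prod>j<m. Poly_Mapping.single \<alpha> 1)"
    by simp
  also have "\<dots> = Poly_Mapping.single (\<Sum>j<m. \<alpha>) 1"
    by (rule prod_single_one)
  finally have "Poly_Mapping.single (\<Sum>j<m. \<alpha>) 1 \<in> \<aa> (m * r)"
    using filtration_power[OF F \<alpha>(1), of m] by simp
  moreover have "Poly_Mapping.lookup (\<Sum>j<m. \<alpha>) i < m * q" for i
    using \<alpha>(2) \<open>m > 0\<close> by (simp add: lookup_sum)
  ultimately show ?thesis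
    unfolding monomial_ideal_not_subset_max_ideal_frob_iff[OF M] by blast
qed

section \<open>The quotients \<open>nu \<aa> q / q\<close> and their monotonicity\<close>

text \<open>A supremum is bounded exactly when each member is, so estimates of \<open>nu\<close>
  reduce to single indices \<open>r\<close>, with no separate case for an unbounded or empty index
  set.\<close>

lemma nu_divide_le_iff:
  assumes "q > 0"
  shows "nu \<aa> q / ereal (real q) \<le> x \<longleftrightarrow>
    (\<forall>r. \<not> \<aa> r \<subseteq> max_ideal_frob q \<longrightarrow> ereal (real r / real q) \<le> x)"
proof -
  have "nu \<aa> q / ereal (real q) \<le> x \<longleftrightarrow> nu \<aa> q \<le> ereal (real q) * x"
    using assms by (simp add: ereal_divide_le_pos)
  also have "\<dots> \<longleftrightarrow> (\<forall>r. \<not> \<aa> r \<subseteq> max_ideal_frob q \<longrightarrow> ereal (real r) \<le> ereal (real q) * x)"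
    unfolding nu_def SUP_le_iff by blast
  also have "\<dots> \<longleftrightarrow> (\<forall>r. \<not> \<aa> r \<subseteq> max_ideal_frob q \<longrightarrow> ereal (real r) / ereal (real q) \<le> x)"
    using assms by (simp add: ereal_divide_le_pos del: ereal_divide)
  finally show ?thesis using assms by simp
qed

text \<open>Scaling by \<open>m = p\<close> takes an escaping index \<open>r\<close> for
  \<open>p ^ e\<close> to \<open>p * r\<close> for \<open>p ^ Suc e\<close>, and the quotient is
  unchanged.\<close>

lemma incseq_nu_divide:
  fixes \<aa> :: "nat \<Rightarrow> ('n::finite, 'k::comm_ring_1) mpoly set"
  assumes "ideal_filtration \<aa>" and "\<And>i. monomial_ideal (\<aa> i)" and p: "p > 0"
  shows "incseq (\<lambda>e. nu \<aa> (p ^ e) / ereal (real (p ^ e)))"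
proof (rule incseq_SucI)
  fix e
  let ?s = "nu \<aa> (p ^ Suc e) / ereal (real (p ^ Suc e))"
  have "ereal (real r / real (p ^ e)) \<le> ?s" if "\<not> \<aa> r \<subseteq> max_ideal_frob (p ^ e)" for r
  proof -
    have "ereal (real (p * r) / real (p ^ Suc e)) \<le> ?s"
      using nu_divide_le_iff[of "p ^ Suc e" \<aa> ?s] p
        not_subset_max_ideal_frob_mult[OF assms that]
      by (metis order_refl power_Suc zero_less_power)
    then show ?thesis using p by simp
  qed
  then show "nu \<aa> (p ^ e) / ereal (real (p ^ e)) \<le> ?s"
    using p by (subst nu_divide_le_iff) auto
qed

section \<open>Values of ideals\<close>

lemma valuation_mono_dvd:
  assumes "valuation v" and "supported_on_ring v" and "f dvd g" and "g \<noteq> 0"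
  shows "v (fract_of f) \<le> v (fract_of g)"
proof -
  obtain h where h: "g = f * h" using assms(3) by (auto simp: dvd_def)
  then have "h \<noteq> 0" using assms(4) by auto
  then have "0 \<le> v (fract_of h)" using assms(2) by (simp add: supported_on_ring_def)
  then show ?thesis
    unfolding h fract_of_mult valuationD(2)[OF assms(1)] by (simp add: ereal_le_add_self)
qed

lemma fract_of_add: "fract_of (f + g) = fract_of f + fract_of g"
  by (simp add: fract_of_def)

text \<open>The elements of value at least \<open>x\<close> form an ideal: sums by the ultrametric
  inequality, multiples because ring elements have nonnegative value.\<close>

lemma val_ideal_gen_ge:
  fixes v :: "'a::idom fract \<Rightarrow> ereal"
  assumes V: "valuation v" and S: "supported_on_ring v"
    and ge: "\<And>f. f \<in> G \<Longrightarrow> x \<le> v (fract_of f)"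
  shows "x \<le> val_ideal v (ideal_gen G)"
proof -
  have 0: "v (fract_of 0) = \<infinity>"
    using V fract_of_eq_0_iff[of "0 :: 'a"] by (simp add: valuation_def)
  have "is_ideal {f. x \<le> v (fract_of f)}"
  proof (rule ideal.subspaceI)
    show "0 \<in> {f. x \<le> v (fract_of f)}" by (simp add: 0)
    show "f + g \<in> {f. x \<le> v (fract_of f)}"
      if "f \<in> {f. x \<le> v (fract_of f)}" "g \<in> {f. x \<le> v (fract_of f)}" for f g
    proof -
      have "x \<le> min (v (fract_of f)) (v (fract_of g))" using that by simp
      also have "\<dots> \<le> v (fract_of (f + g))"
        using V by (simp only: fract_of_add valuation_def)
      finally show ?thesis by simp
    qed
    show "h * f \<in> {f. x \<le> v (fract_of f)}" if "f \<in> {f. x \<le> v (fract_of f)}" for h f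
    proof (cases "h * f = 0")
      case True
      show ?thesis unfolding True by (simp add: 0)
    next
      case False
      have "v (fract_of f) \<le> v (fract_of (h * f))"
        by (rule valuation_mono_dvd[OF V S _ False]) simp
      with that show ?thesis by simp
    qed
  qed
  then have "ideal_gen G \<subseteq> {f. x \<le> v (fract_of f)}"
    using ge by (intro ideal.span_minimal) auto
  then show ?thesis unfolding val_ideal_def by (auto intro!: INF_greatest)
qed

lemma valuation_finite_nonneg:
  assumes "valuation v" and "supported_on_ring v" and "f \<noteq> 0"
  obtains x where "v (fract_of f) = ereal x" and "x \<ge> 0"
proof -
  have "\<bar>v (fract_of f)\<bar> \<noteq> \<infinity>"
    by (rule valuationD(1)[OF assms(1)]) (simp add: fract_of_eq_0_iff assms(3))
  moreover have "0 \<le> v (fract_of f)" using assms(2,3) by (simp add: supported_on_ring_def)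
  ultimately show ?thesis using that by (cases "v (fract_of f)") auto
qed

lemma var_nonzero: "(var i :: ('n, 'k::comm_ring_1) mpoly) \<noteq> 0"
  by (metis lookup_single_eq lookup_zero var_def zero_neq_one)

text \<open>It suffices to test the generators: \<open>var i ^ q\<close> has value \<open>q\<close>
  times that of \<open>var i\<close>, which lies in \<open>max_ideal\<close>.\<close>

lemma val_max_ideal_frob_ge:
  fixes v :: "('n::{finite,linorder}, 'k::field) mpoly fract \<Rightarrow> ereal"
  assumes V: "valuation v" and S: "supported_on_ring v" and "q > 0"
  shows "ereal (real q) * val_ideal v max_ideal \<le> val_ideal v (max_ideal_frob q)"
  unfolding max_ideal_frob_def
proof (rule val_ideal_gen_ge[OF V S])
  fix f :: "('n, 'k) mpoly"
  assume "f \<in> range (\<lambda>i. var i ^ q)"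
  then obtain i where i: "f = var i ^ q" by blast
  obtain x where x: "v (fract_of (var i)) = ereal x"
    using valuation_finite_nonneg[OF V S var_nonzero] by metis
  have "val_ideal v max_ideal \<le> v (fract_of (var i))"
    unfolding val_ideal_def max_ideal_def
    by (rule INF_lower) (simp add: var_nonzero ideal.span_base)
  then have "ereal (real q) * val_ideal v max_ideal \<le> ereal (real q) * v (fract_of (var i))"
    by (intro ereal_mult_left_mono) auto
  also have "\<dots> = v (fract_of f)"
    using valuation_power[OF V var_nonzero x, of "q - 1"] \<open>q > 0\<close> by (simp add: i x)
  finally show "ereal (real q) * val_ideal v max_ideal \<le> v (fract_of f)" .
qed

lemma skew_waldschmidt_le:
  assumes "ideal_filtration \<aa>" and "valuation v" and "supported_on_ring v"
  shows "ereal (real r) * skew_waldschmidt v \<aa> \<le> val_ideal v (\<aa> r)"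
proof (cases "r = 0")
  \<comment> \<open>The constant may be infinite; then the left side is zero by the convention
    \<open>0 * \<infinity> = 0\<close>.\<close>
  case True
  then show ?thesis using val_ideal_nonneg[OF assms(3)] by (simp add: zero_ereal_def[symmetric])
next
  case False
  have "skew_waldschmidt v \<aa> \<le> val_ideal v (\<aa> r) / ereal (real r)"
    unfolding skew_waldschmidt_eq_INF[OF assms] using False by (intro INF_lower) auto
  then show ?thesis using False by (simp add: ereal_le_divide_pos)
qed

section \<open>The upper bound for a fixed \<open>q\<close>\<close>

lemma nu_divide_le:
  fixes \<aa> :: "nat \<Rightarrow> ('n::{finite,linorder}, 'k::field) mpoly set"
  assumes F: "ideal_filtration \<aa>" and M: "\<And>i. monomial_ideal (\<aa> i)"
    and V: "valuation v" and S: "supported_on_ring v"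
    and pos: "skew_waldschmidt v \<aa> > 0" and "q > 0"
  shows "nu \<aa> q / ereal (real q) \<le> v (fract_of (\<Prod>i\<in>UNIV. var i)) / skew_waldschmidt v \<aa>"
  unfolding nu_divide_le_iff[OF \<open>q > 0\<close>]
proof (intro allI impI)
  fix r
  assume "\<not> \<aa> r \<subseteq> max_ideal_frob q"
  then obtain \<alpha> where \<alpha>: "Poly_Mapping.single \<alpha> 1 \<in> \<aa> r" "\<And>i. Poly_Mapping.lookup \<alpha> i < q"
    unfolding monomial_ideal_not_subset_max_ideal_frob_iff[OF M] by blast
  let ?X = "\<Prod>i\<in>UNIV. var i :: ('n, 'k) mpoly"
  have X0: "?X \<noteq> 0" by (simp add: var_nonzero)
  obtain x where x: "v (fract_of ?X) = ereal x" "x \<ge> 0"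
    by (rule valuation_finite_nonneg[OF V S X0])
  have "ereal (real r) * skew_waldschmidt v \<aa> \<le> val_ideal v (\<aa> r)"
    by (rule skew_waldschmidt_le[OF F V S])
  also have "\<dots> \<le> v (fract_of (Poly_Mapping.single \<alpha> 1))"
    unfolding val_ideal_def using \<alpha>(1)
    by (intro INF_lower) (auto simp: monomial_eq_prod_var var_nonzero)
  \<comment> \<open>All exponents of \<open>\<alpha>\<close> are below \<open>q\<close>, so the
    monomial divides \<open>?X ^ q\<close>.\<close>
  also have "\<dots> \<le> v (fract_of (?X ^ q))"
  proof (rule valuation_mono_dvd[OF V S])
    show "Poly_Mapping.single \<alpha> 1 dvd ?X ^ q"
      unfolding monomial_eq_prod_var prod_power_distrib
      using \<alpha>(2) by (intro prod_dvd_prod le_imp_power_dvd less_imp_le)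
    show "?X ^ q \<noteq> 0" using X0 by simp
  qed
  also have "\<dots> = ereal (real q * x)"
    using valuation_power[OF V X0 x(1), of "q - 1"] \<open>q > 0\<close> by simp
  finally have le: "ereal (real r) * skew_waldschmidt v \<aa> \<le> ereal (real q * x)" .
  show "ereal (real r / real q) \<le> v (fract_of ?X) / skew_waldschmidt v \<aa>"
  proof (cases "skew_waldschmidt v \<aa>")
    case (real w)
    then show ?thesis
      using le pos \<open>q > 0\<close> by (simp add: x field_simps)
  next
    \<comment> \<open>A positive \<open>r\<close> would make the left side of \<open>le\<close>
      infinite, so \<open>r = 0\<close>; the quotient by \<open>\<infinity>\<close> is zero as
      well.\<close>
    case PInf
    then have "r = 0" using le by (cases "r = 0") auto
    then show ?thesis using PInf by (simp add: x)
  next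
    case MInf
    then show ?thesis using pos by simp
  qed
qed

section \<open>Passing to the limit in both directions\<close>

theorem lemma6p10:
  fixes p :: nat
    and \<aa> :: "nat \<Rightarrow> ('n::{finite,linorder}, 'k::field) mpoly set"
    and v :: "('n, 'k) mpoly fract \<Rightarrow> ereal"
  assumes "prime p" and "CHAR('k) = p"
    and "ideal_filtration \<aa>" and "\<And>i. monomial_ideal (\<aa> i)"
    and "valuation v" and "supported_on_ring v"
  shows "(skew_waldschmidt v \<aa> > 0 \<longrightarrow>
            F_threshold_exists p \<aa> \<and>
            F_threshold p \<aa> \<le> v (fract_of (\<Prod>i\<in>UNIV. var i)) / skew_waldschmidt v \<aa>)
       \<and> (val_ideal v max_ideal > 0 \<and> F_threshold_exists p \<aa> \<longrightarrow>
            skew_waldschmidt v \<aa> > 0)"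
proof (intro conjI impI)
  let ?s = "\<lambda>e. nu \<aa> (p ^ e) / ereal (real (p ^ e))"
  have p: "p > 1" using assms(1) by (rule prime_gt_1_nat)
  have inc: "incseq ?s"
    using p by (intro incseq_nu_divide assms(3,4)) simp
  {
    assume pos: "skew_waldschmidt v \<aa> > 0"
    let ?X = "\<Prod>i\<in>UNIV. var i :: ('n, 'k) mpoly"
    let ?b = "v (fract_of ?X) / skew_waldschmidt v \<aa>"
    have le: "?s e \<le> ?b" for e
      using p by (intro nu_divide_le assms(3-6) pos) simp
    have lim: "?s \<longlonglongrightarrow> (SUP e. ?s e)"
      by (rule LIMSEQ_SUP[OF inc])
    have sup_le: "(SUP e. ?s e) \<le> ?b"
      by (rule SUP_least) (rule le)
    show "F_threshold p \<aa> \<le> ?b"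
      unfolding F_threshold_def limI[OF lim] by (rule sup_le)
    \<comment> \<open>The constant 1 lies in \<open>\<aa> 0\<close> but not in the maximal ideal. So
      the index 0 counts at \<open>e = 0\<close>, which bounds the supremum below by 0 and, together
      with the finite bound \<open>?b\<close>, makes it a real number.\<close>
    have "\<not> \<aa> 0 \<subseteq> max_ideal_frob (p ^ 0)"
    proof
      assume "\<aa> 0 \<subseteq> max_ideal_frob (p ^ 0)"
      then have "Poly_Mapping.single (0 :: 'n \<Rightarrow>\<^sub>0 nat) (1::'k) \<in> max_ideal_frob 1"
        using filtrationD(1)[OF assms(3)] by auto
      then show False by (simp only: monomial_mem_max_ideal_frob_iff) simp
    qed
    then have "ereal (real 0 / real (p ^ 0)) \<le> ?s 0"
      by (rule nu_divide_le_iff[THEN iffD1, OF _ order_refl, rule_format, rotated]) simp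
    also have "?s 0 \<le> (SUP e. ?s e)" by (rule SUP_upper) simp
    finally have "0 \<le> (SUP e. ?s e)" by (simp add: zero_ereal_def)
    moreover have "?b < \<infinity>"
    proof -
      have "?X \<noteq> 0" by (simp add: var_nonzero)
      then obtain x where "v (fract_of ?X) = ereal x"
        using valuation_finite_nonneg[OF assms(5,6)] by metis
      then show ?thesis using pos by (cases "skew_waldschmidt v \<aa>") auto
    qed
    ultimately obtain c where "(SUP e. ?s e) = ereal c"
      using sup_le by (cases "SUP e. ?s e") auto
    then show "F_threshold_exists p \<aa>"
      unfolding F_threshold_exists_def using lim by auto
  }
  assume "val_ideal v max_ideal > 0 \<and> F_threshold_exists p \<aa>"
  then obtain c where pos: "val_ideal v max_ideal > 0" and c: "?s \<longlonglongrightarrow> ereal c"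
    unfolding F_threshold_exists_def by blast
  \<comment> \<open>\<open>N > c\<close> is what forces containment below; the maximum with 0 also
    makes \<open>N\<close> positive, as the divisions by \<open>N\<close> require.\<close>
  obtain N :: nat where N: "N > max c 0" using reals_Archimedean2 by blast
  \<comment> \<open>Otherwise \<open>N\<close> would be one of the quotients bounded by
    \<open>?s e\<close>, and an increasing sequence stays below its limit \<open>c\<close>.\<close>
  have sub: "\<aa> (N * p ^ e) \<subseteq> max_ideal_frob (p ^ e)" for e
  proof (rule ccontr)
    assume not: "\<not> \<aa> (N * p ^ e) \<subseteq> max_ideal_frob (p ^ e)"
    have "?s e \<le> ereal c" by (rule incseq_le[OF inc c])
    then have "ereal (real (N * p ^ e) / real (p ^ e)) \<le> ereal c"
      using nu_divide_le_iff[of "p ^ e" \<aa> "ereal c"] p not by auto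
    then show False using N p by simp
  qed
  let ?\<delta> = "val_ideal v max_ideal"
  have "?\<delta> / ereal (real N) \<le> val_ideal v (\<aa> (N * p ^ e)) / ereal (real (N * p ^ e))" for e
  proof -
    have "ereal (real (p ^ e)) * ?\<delta> \<le> val_ideal v (max_ideal_frob (p ^ e))"
      using p by (intro val_max_ideal_frob_ge assms(5,6)) simp
    also have "\<dots> \<le> val_ideal v (\<aa> (N * p ^ e))"
      by (rule val_ideal_antimono[OF sub])
    finally have "ereal (real (p ^ e)) * ?\<delta> / ereal (real (N * p ^ e))
        \<le> val_ideal v (\<aa> (N * p ^ e)) / ereal (real (N * p ^ e))"
      using N p by (intro ereal_divide_right_mono) auto
    moreover have "ereal (real (p ^ e)) * ?\<delta> / ereal (real (N * p ^ e)) = ?\<delta> / ereal (real N)"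
      using N p by (cases ?\<delta>) auto
    ultimately show ?thesis by simp
  qed
  \<comment> \<open>The defining limit of the skew Waldschmidt constant exists along all indices, so
    the uniform lower bound on this subsequence passes to it.\<close>
  moreover have "strict_mono (\<lambda>e. N * p ^ e)"
    using N p by (intro strict_monoI) (simp add: power_strict_increasing)
  then have "(\<lambda>e. val_ideal v (\<aa> (N * p ^ e)) / ereal (real (N * p ^ e)))
      \<longlonglongrightarrow> skew_waldschmidt v \<aa>"
    unfolding skew_waldschmidt_eq_INF[OF assms(3,5,6)]
    by (rule LIMSEQ_subseq_LIMSEQ[OF skew_waldschmidt_limit[OF assms(3,5,6)], unfolded o_def])
  ultimately have "?\<delta> / ereal (real N) \<le> skew_waldschmidt v \<aa>"
    by (intro LIMSEQ_le_const) auto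
  moreover have "?\<delta> / ereal (real N) > 0"
    using pos N by (cases ?\<delta>) auto
  ultimately show "skew_waldschmidt v \<aa> > 0" by simp
qed

end
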